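(* Fix an integer $k\ge 0$ and let $r\ge \max(k,1)$. Let $a_N=(N-1)!$ for $N\ge 1$ and let $\delta$ be the difference operator on sequences, $(\delta a)_N=a_N-a_{N-1}$. Then $u_{r+k,r}=(\delta^k a)_{r+k}$. In particular, if moreover $k\ge 1$, then $u_{r+k,r}=u_{r+k,r+1}-u_{r+k-1,r}$.
   Context: The Turán graph $T(n,r)$ ($1\le r\le n$) is the complete $r$-partite graph on $n$ vertices whose part sizes are all $\lceil n/r\rceil$ or $\lfloor n/r\rfloor$; two vertices are adjacent iff in different parts. $u_{n,r}$ denotes the number of acyclic orientations of $T(n,r)$ with a unique sink equal to a fixed vertex $s$ (this number is independent of $s$). An acyclic orientation directs all edges without a directed cycle; a sink is a vertex with no outgoing edge. *)

theory Defs
  imports Complex_Main "HOL-Library.Disjoint_Sets"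
begin

text \<open>A graph is given by its vertex set and its set of two-element edges.  The Turan graph is
  determined only up to isomorphism, so it is a predicate on such pairs rather than one
  chosen labelled graph.\<close>

definition complete_multipartite_edges :: "'a set set \<Rightarrow> 'a set set" where
  "complete_multipartite_edges P = {{x, y} |x y. \<exists>A\<in>P. \<exists>B\<in>P. A \<noteq> B \<and> x \<in> A \<and> y \<in> B}"

definition turan_graph :: "nat \<Rightarrow> nat \<Rightarrow> 'a set \<Rightarrow> 'a set set \<Rightarrow> bool" where
  "turan_graph n r V E \<longleftrightarrow>
     1 \<le> r \<and> r \<le> n \<and> finite V \<and> card V = n \<and>
     (\<exists>P. partition_on V P \<and> card P = r \<and>
          (\<forall>A\<in>P. int (card A) = \<lceil>real n / real r\<rceil> \<or> int (card A) = \<lfloor>real n / real r\<rfloor>) \<and>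
          E = complete_multipartite_edges P)"

text \<open>An orientation is the set of its arcs: the arc \<open>(x, y)\<close> is the edge \<open>{x, y}\<close> directed
  from \<open>x\<close> to \<open>y\<close>.\<close>

definition orientation :: "'a set set \<Rightarrow> ('a \<times> 'a) set \<Rightarrow> bool" where
  "orientation E D \<longleftrightarrow>
     (\<forall>x y. (x, y) \<in> D \<longrightarrow> {x, y} \<in> E) \<and>
     (\<forall>x y. {x, y} \<in> E \<longrightarrow> ((x, y) \<in> D \<longleftrightarrow> (y, x) \<notin> D))"

definition sinks :: "'a set \<Rightarrow> ('a \<times> 'a) set \<Rightarrow> 'a set" where
  "sinks V D = {v \<in> V. \<forall>w. (v, w) \<notin> D}"

definition num_unique_sink :: "'a set \<Rightarrow> 'a set set \<Rightarrow> 'a \<Rightarrow> nat" where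
  "num_unique_sink V E s = card {D. orientation E D \<and> acyclic D \<and> sinks V D = {s}}"

text \<open>Sequences are indexed by positive integers; the values at index 0 are junk, as is
  the value of a \<open>k\<close>-fold difference at an index \<open>N \<le> k\<close>.\<close>

definition shifted_fact :: "nat \<Rightarrow> int" where
  "shifted_fact N = fact (N - 1)"

definition backward_diff :: "(nat \<Rightarrow> int) \<Rightarrow> nat \<Rightarrow> int" where
  "backward_diff a N = a N - a (N - 1)"

text \<open>Existence of Turan graphs, so that the hypothesis \<open>turan_graph\<close> is satisfiable.\<close>

lemma card_residue_class:
  fixes n r j :: nat
  assumes "j < r"
  shows "card {i. i < n \<and> i mod r = j} = n div r + (if j < n mod r then 1 else 0)"
proof (induction n)
  case 0
  then show ?case by simp
next
  case (Suc n)
  have eq: "{i. i < Suc n \<and> i mod r = j} =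
      (if n mod r = j then insert n {i. i < n \<and> i mod r = j} else {i. i < n \<and> i mod r = j})"
    by (auto simp: less_Suc_eq)
  have fin: "finite {i. i < n \<and> i mod r = j}" by simp
  have "n mod r < r" using assms by simp
  with assms Suc fin show ?case
    by (auto simp: eq div_Suc mod_Suc)
qed

lemma turan_graph_exists:
  assumes "1 \<le> r" "r \<le> n"
  shows "\<exists>(V :: nat set) E. turan_graph n r V E"
proof -
  define C where "C j = {i. i < n \<and> i mod r = j}" for j
  define P where "P = C ` {..<r}"
  have mem: "j \<in> C j" if "j < r" for j using that assms by (auto simp: C_def)
  have inj: "inj_on C {..<r}" using mem by (force simp: inj_on_def C_def)
  have part: "partition_on {..<n} P"
  proof -
    have "\<Union> P = {..<n}" using assms by (auto simp: P_def C_def)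
    moreover have "disjoint P" unfolding disjoint_def by (auto simp: P_def C_def)
    moreover have "{} \<notin> P" using mem by (auto simp: P_def)
    ultimately show ?thesis by (simp add: partition_on_def)
  qed
  have fl: "\<lfloor>real n / real r\<rfloor> = int (n div r)"
    by (simp add: floor_divide_of_nat_eq)
  have ce: "\<lceil>real n / real r\<rceil> = int (n div r) + 1" if "0 < n mod r"
  proof (rule ceiling_unique)
    have *: "real n = real (n div r) * real r + real (n mod r)"
      by (metis div_mult_mod_eq of_nat_add of_nat_mult)
    have "real (n mod r) < real r" using assms by simp
    then show "real n / real r \<le> of_int (int (n div r) + 1)"
      using assms by (subst *) (simp add: divide_simps algebra_simps)
    show "of_int (int (n div r) + 1) - 1 < real n / real r"
      using that assms by (subst *) (simp add: divide_simps algebra_simps)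
  qed
  have "int (card A) = \<lceil>real n / real r\<rceil> \<or> int (card A) = \<lfloor>real n / real r\<rfloor>" if "A \<in> P" for A
  proof -
    obtain j where "j < r" "A = C j" using \<open>A \<in> P\<close> unfolding P_def by blast
    then have "card A = n div r + (if j < n mod r then 1 else 0)"
      by (simp add: C_def card_residue_class)
    then show ?thesis using fl ce by auto
  qed
  moreover have "card P = r" using inj by (simp add: P_def card_image)
  ultimately have "turan_graph n r {..<n} (complete_multipartite_edges P)"
    unfolding turan_graph_def using assms part by auto
  then show ?thesis by blast
qed

end

theory Submission
  imports Defs
begin

text \<open>As \<open>r \<ge> k\<close>, all parts have size one or two.  Two sinks of an acyclic orientation of a complete
  multipartite graph lie in the same part, and deleting a set \<open>S\<close> of sinks inside one part is a
  bijection onto all acyclic orientations of the rest, since every edge at \<open>S\<close> is directed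
  into \<open>S\<close>.  Inclusion-exclusion over the sinks in each part therefore gives a recursion for the
  number of acyclic orientations of \<open>n\<close> vertices with \<open>k\<close> parts of size two, which a discrete
  Leibniz rule for \<open>n! = n (n - 1)!\<close> shows to be solved by \<open>(\<delta>\<^sup>k a)\<^sub>n\<^sub>+\<^sub>1\<close>.  The same deletion then
  expresses the orientations with unique sink \<open>s\<close> through these totals.\<close>

section \<open>Acyclic orientations of complete multipartite graphs and their sinks\<close>

definition acyclic_orientations :: "'a set set \<Rightarrow> ('a \<times> 'a) set set" where
  "acyclic_orientations E = {D. orientation E D \<and> acyclic D}"

text \<open>A part is a fibre of the labelling \<open>p\<close>, so that deleting vertices does not change \<open>p\<close>.\<close>

definition label_edges :: "'a set \<Rightarrow> ('a \<Rightarrow> 'b) \<Rightarrow> 'a set set" where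
  "label_edges V p = {{x, y} |x y. x \<in> V \<and> y \<in> V \<and> p x \<noteq> p y}"

lemma doubleton_in_label_edges [simp]:
  "{x, y} \<in> label_edges V p \<longleftrightarrow> x \<in> V \<and> y \<in> V \<and> p x \<noteq> p y"
  unfolding label_edges_def by (auto simp: doubleton_eq_iff)

lemma arc_in_label_edges:
  assumes "D \<in> acyclic_orientations (label_edges V p)" "(x, y) \<in> D"
  shows "x \<in> V" "y \<in> V" "p x \<noteq> p y"
proof -
  have "{x, y} \<in> label_edges V p"
    using assms unfolding acyclic_orientations_def orientation_def by blast
  then show "x \<in> V" "y \<in> V" "p x \<noteq> p y" by simp_all
qed

lemma acyclic_orientations_subset:
  "acyclic_orientations (label_edges V p) \<subseteq> Pow (V \<times> V)"
  using arc_in_label_edges by fast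

lemma finite_acyclic_orientations:
  assumes "finite V"
  shows "finite {D \<in> acyclic_orientations (label_edges V p). Q D}"
proof (rule finite_subset)
  show "{D \<in> acyclic_orientations (label_edges V p). Q D} \<subseteq> Pow (V \<times> V)"
    using acyclic_orientations_subset by blast
qed (use assms in simp)

lemma sink_exists:
  assumes "finite V" "V \<noteq> {}" "D \<in> acyclic_orientations (label_edges V p)"
  shows "sinks V D \<noteq> {}"
proof -
  have sub: "D \<subseteq> V \<times> V" using acyclic_orientations_subset assms(3) by blast
  then have "finite D" using assms(1) finite_subset by blast
  moreover have "acyclic D" using assms(3) by (simp add: acyclic_orientations_def)
  ultimately have "wf (D\<inverse>)" by (rule finite_acyclic_wf_converse)
  then obtain v where "v \<in> V" "\<forall>w. (w, v) \<in> D\<inverse> \<longrightarrow> w \<notin> V"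
    using assms(2) unfolding wf_eq_minimal by (metis ex_in_conv)
  then show ?thesis using sub unfolding sinks_def by auto
qed

text \<open>Vertices of different labels are adjacent, and the tail of the arc between them is not a
  sink. Hence the sinks of an orientation single out one part, which later makes the count by parts
  a disjoint sum.\<close>

lemma sinks_same_label:
  assumes "D \<in> acyclic_orientations (label_edges V p)" "x \<in> sinks V D" "y \<in> sinks V D"
  shows "p x = p y"
proof (rule ccontr)
  assume "p x \<noteq> p y"
  then have "{x, y} \<in> label_edges V p" using assms by (simp add: sinks_def)
  then have "(x, y) \<in> D \<or> (y, x) \<in> D"
    using assms(1) unfolding acyclic_orientations_def orientation_def by blast
  then show False using assms by (auto simp: sinks_def)
qed

section \<open>Deleting sinks that share a part\<close>

text \<open>A path that reaches \<open>S\<close> cannot be continued, so no cycle meets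
  \<open>S\<close>. As all arcs of \<open>R\<close> end in \<open>S\<close>, a cycle would use arcs
  of \<open>F\<close> only.\<close>

lemma acyclic_add_arcs_into_sinks:
  assumes "acyclic F" "\<And>x y. (x, y) \<in> F \<union> R \<Longrightarrow> x \<notin> S" "\<And>x y. (x, y) \<in> R \<Longrightarrow> y \<in> S"
  shows "acyclic (F \<union> R)"
proof -
  have "(x, y) \<in> F\<^sup>+ \<or> y \<in> S" if "(x, y) \<in> (F \<union> R)\<^sup>+" for x y
    using that
  proof (induction rule: trancl_induct)
    case (base y)
    then show ?case using assms(3) by blast
  next
    case (step y z)
    then have "(x, y) \<in> F\<^sup>+" using assms(2) by blast
    then show ?case using step.hyps(2) assms(3) by (meson UnE trancl.trancl_into_trancl)
  qed
  moreover have "x \<notin> S" if "(x, y) \<in> (F \<union> R)\<^sup>+" for x y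
    using tranclD[OF that] assms(2) by blast
  ultimately show ?thesis using assms(1) unfolding acyclic_def by blast
qed

text \<open>The common label \<open>c\<close> means that there are no edges inside \<open>S\<close>,
  so making \<open>S\<close> consist of sinks forces the direction of every edge that meets
  \<open>S\<close> and leaves the rest free. Restricting to \<open>V - S\<close> is inverted by
  adding the forced arcs back, which creates no cycle.\<close>

lemma card_prescribed_sinks:
  assumes "S \<subseteq> V" "\<And>x. x \<in> S \<Longrightarrow> p x = c"
  shows "card {D \<in> acyclic_orientations (label_edges V p). S \<subseteq> sinks V D} =
    card (acyclic_orientations (label_edges (V - S) p))"
proof -
  let ?W = "(V - S) \<times> (V - S)"
  \<comment> \<open>The forced arcs: the neighbours of a vertex in \<open>S\<close> are exactly the
    vertices of a label other than \<open>c\<close>, and these automatically lie outside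
    \<open>S\<close>.\<close>
  define R where "R = {(x, y). x \<in> V \<and> y \<in> S \<and> p x \<noteq> c}"
  have split: "D \<inter> ?W \<union> R = D"
    if "D \<in> acyclic_orientations (label_edges V p)" "S \<subseteq> sinks V D" for D
  proof -
    have "R \<subseteq> D"
    proof
      fix e assume "e \<in> R"
      then obtain x y where e: "e = (x, y)" "x \<in> V" "y \<in> S" "p x \<noteq> c" by (auto simp: R_def)
      then have "{x, y} \<in> label_edges V p" "(y, x) \<notin> D"
        using assms that(2) by (auto simp: sinks_def)
      then show "e \<in> D"
        using that(1) e(1) unfolding acyclic_orientations_def orientation_def by blast
    qed
    moreover have "D \<subseteq> ?W \<union> R"
    proof
      fix e assume e: "e \<in> D"
      obtain x y where xy: "e = (x, y)" by fastforce
      have "x \<in> V" "y \<in> V" "p x \<noteq> p y" using arc_in_label_edges[OF that(1)] e xy by auto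
      moreover have "x \<notin> S" using that(2) e xy by (auto simp: sinks_def)
      ultimately show "e \<in> ?W \<union> R"
        using assms(2)[of y] xy by (cases "y \<in> S") (simp_all add: R_def)
    qed
    ultimately show ?thesis by blast
  qed
  have "bij_betw (\<lambda>D. D \<inter> ?W)
      {D \<in> acyclic_orientations (label_edges V p). S \<subseteq> sinks V D}
      (acyclic_orientations (label_edges (V - S) p))"
  proof (rule bij_betwI[where g = "\<lambda>F. F \<union> R"])
    show "(\<lambda>D. D \<inter> ?W) \<in> {D \<in> acyclic_orientations (label_edges V p). S \<subseteq> sinks V D} \<rightarrow>
        acyclic_orientations (label_edges (V - S) p)"
    proof
      fix D assume "D \<in> {D \<in> acyclic_orientations (label_edges V p). S \<subseteq> sinks V D}"
      then have D: "orientation (label_edges V p) D" "acyclic D"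
        by (auto simp: acyclic_orientations_def)
      have "acyclic (D \<inter> ?W)" using D(2) by (rule acyclic_subset) simp
      moreover have "orientation (label_edges (V - S) p) (D \<inter> ?W)"
        unfolding orientation_def
      proof (intro conjI allI impI)
        fix x y assume "(x, y) \<in> D \<inter> ?W"
        moreover from this have "{x, y} \<in> label_edges V p"
          using D(1) unfolding orientation_def by blast
        ultimately show "{x, y} \<in> label_edges (V - S) p" by simp
      next
        fix x y assume *: "{x, y} \<in> label_edges (V - S) p"
        then have "{x, y} \<in> label_edges V p" by simp
        then have "((x, y) \<in> D) = ((y, x) \<notin> D)" using D(1) unfolding orientation_def by blast
        then show "((x, y) \<in> D \<inter> ?W) = ((y, x) \<notin> D \<inter> ?W)" using * by simp
      qed
      ultimately show "D \<inter> ?W \<in> acyclic_orientations (label_edges (V - S) p)"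
        by (simp add: acyclic_orientations_def)
    qed
    show "(\<lambda>F. F \<union> R) \<in> acyclic_orientations (label_edges (V - S) p) \<rightarrow>
        {D \<in> acyclic_orientations (label_edges V p). S \<subseteq> sinks V D}"
    proof
      fix F assume F: "F \<in> acyclic_orientations (label_edges (V - S) p)"
      then have o: "orientation (label_edges (V - S) p) F" and a: "acyclic F"
        by (auto simp: acyclic_orientations_def)
      have FW: "F \<subseteq> ?W" using acyclic_orientations_subset F by blast
      have out: "x \<notin> S" if "(x, y) \<in> F \<union> R" for x y
        using that FW assms(2) by (auto simp: R_def)
      have "acyclic (F \<union> R)"
        by (rule acyclic_add_arcs_into_sinks[OF a out]) (auto simp: R_def)
      moreover have "orientation (label_edges V p) (F \<union> R)"
        unfolding orientation_def
      proof (intro conjI allI impI)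
        fix x y assume "(x, y) \<in> F \<union> R"
        then show "{x, y} \<in> label_edges V p"
          using arc_in_label_edges[OF F] assms by (auto simp: R_def)
      next
        fix x y assume "{x, y} \<in> label_edges V p"
        then have xy: "x \<in> V" "y \<in> V" "p x \<noteq> p y" by auto
        consider "x \<in> S" | "y \<in> S" | "x \<notin> S" "y \<notin> S" by blast
        then show "((x, y) \<in> F \<union> R) = ((y, x) \<notin> F \<union> R)"
        proof cases
          case 1
          then have "(y, x) \<in> R" using xy assms(2) by (auto simp: R_def)
          then show ?thesis using out 1 by blast
        next
          case 2
          then have "(x, y) \<in> R" using xy assms(2) by (auto simp: R_def)
          then show ?thesis using out 2 by blast
        next
          case 3
          then have "{x, y} \<in> label_edges (V - S) p" using xy by simp
          then have "((x, y) \<in> F) = ((y, x) \<notin> F)" using o unfolding orientation_def by blast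
          then show ?thesis using 3 by (simp add: R_def)
        qed
      qed
      moreover have "S \<subseteq> sinks V (F \<union> R)" using out assms(1) by (auto simp: sinks_def)
      ultimately show "F \<union> R \<in> {D \<in> acyclic_orientations (label_edges V p). S \<subseteq> sinks V D}"
        by (simp add: acyclic_orientations_def)
    qed
    show "D \<inter> ?W \<union> R = D"
      if "D \<in> {D \<in> acyclic_orientations (label_edges V p). S \<subseteq> sinks V D}" for D
      using split that by blast
    show "(F \<union> R) \<inter> ?W = F" if "F \<in> acyclic_orientations (label_edges (V - S) p)" for F
      using acyclic_orientations_subset[of "V - S" p] that by (auto simp: R_def)
  qed
  then show ?thesis by (rule bij_betw_same_card)
qed

section \<open>A recursion for the iterated differences of factorials\<close>

text \<open>For \<open>k = 0\<close> this is n! = n (n - 1)!. Applying the difference operator to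
  the identity for \<open>k\<close> gives the one for \<open>Suc k\<close>: since the coefficient is
  linear in \<open>n\<close>, the Leibniz rule leaves only one term of lower order. The bound
  \<open>k < n\<close> keeps all values away from the junk at index 0.\<close>

lemma fact_diff_rec:
  assumes "k < n"
  shows "(backward_diff ^^ k) shifted_fact (n + 1) =
    int (n - k) * (backward_diff ^^ k) shifted_fact n +
    int k * (backward_diff ^^ (k - 1)) shifted_fact n"
  using assms
proof (induction k arbitrary: n)
  case 0
  then show ?case by (cases n) (simp_all add: shifted_fact_def)
next
  case (Suc k)
  then obtain m where n: "n = Suc m" "k < m" by (cases n) auto
  \<comment> \<open>For \<open>k > 0\<close> the outermost difference is unfolded. For
    \<open>k = 0\<close>, where \<open>k - 1\<close> truncates to 0, the factor \<open>int k\<close>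
    makes both sides vanish.\<close>
  have cancel: "int k * (backward_diff ^^ k) shifted_fact (Suc m) =
      int k * ((backward_diff ^^ (k - 1)) shifted_fact (Suc m) -
               (backward_diff ^^ (k - 1)) shifted_fact m)"
    by (cases k) (simp_all add: backward_diff_def)
  have "(backward_diff ^^ Suc k) shifted_fact (n + 1) =
      (backward_diff ^^ k) shifted_fact (Suc m + 1) - (backward_diff ^^ k) shifted_fact (m + 1)"
    by (simp add: backward_diff_def n)
  also have "\<dots> = int (Suc m - k) * (backward_diff ^^ k) shifted_fact (Suc m) +
      int k * (backward_diff ^^ (k - 1)) shifted_fact (Suc m) -
      (int (m - k) * (backward_diff ^^ k) shifted_fact m +
       int k * (backward_diff ^^ (k - 1)) shifted_fact m)"
    using Suc.IH[of "Suc m"] Suc.IH[of m] n by simp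
  also have "\<dots> = int (n - Suc k) * (backward_diff ^^ Suc k) shifted_fact n +
      int (Suc k) * (backward_diff ^^ (Suc k - 1)) shifted_fact n"
    using n cancel by (simp add: backward_diff_def Suc_diff_le algebra_simps)
  finally show ?case .
qed

section \<open>Parts of size one and two\<close>

lemma fibre_cases:
  fixes p :: "'a \<Rightarrow> 'b"
  assumes "finite V" "\<And>c. card {y \<in> V. p y = c} \<le> 2" "x \<in> V"
  obtains (single) "{y \<in> V. p y = p x} = {x}"
  | (pair) y where "y \<in> V" "y \<noteq> x" "p y = p x" "{y \<in> V. p y = p x} = {x, y}"
proof (cases "{y \<in> V. p y = p x} = {x}")
  case True
  then show ?thesis by (rule single)
next
  case False
  then obtain y where y: "y \<in> V" "y \<noteq> x" "p y = p x" using assms(3) by auto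
  have "card {z \<in> V. p z = p x} \<le> card {x, y}" using assms(2)[of "p x"] y(2) by simp
  then have "{x, y} = {y \<in> V. p y = p x}"
    using assms(1,3) y by (intro card_seteq) auto
  then show ?thesis using y pair by metis
qed

text \<open>This and the next lemma track the number of vertices minus the number of labels, which
  is the number of pairs when all parts have size at most two. Deleting a singleton part keeps it;
  deleting one or both vertices of a pair lowers it by one.\<close>

lemma card_image_remove_single:
  assumes "finite V" "x \<in> V" "{y \<in> V. p y = p x} = {x}"
  shows "card (p ` (V - {x})) = card (p ` V) - 1"
proof -
  have "p ` (V - {x}) = p ` V - {p x}" using assms(3) by auto
  then show ?thesis using assms by simp
qed

lemma card_image_remove_pair:
  assumes "finite V" "x \<in> V" "y \<in> V" "y \<noteq> x" "p y = p x" "{y \<in> V. p y = p x} = {x, y}"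
  shows "card (p ` (V - {x})) = card (p ` V)" "card (p ` (V - {x, y})) = card (p ` V) - 1"
proof -
  have "p ` (V - {x}) = p ` V"
  proof (intro equalityI subsetI)
    fix c assume "c \<in> p ` V"
    then obtain z where "z \<in> V" "c = p z" by blast
    then have "c = p (if z = x then y else z)" "(if z = x then y else z) \<in> V - {x}"
      using assms(3-5) by auto
    then show "c \<in> p ` (V - {x})" by blast
  qed auto
  then show "card (p ` (V - {x})) = card (p ` V)" by simp
  have "p ` (V - {x, y}) = p ` V - {p x}" using assms(5,6) by auto
  then show "card (p ` (V - {x, y})) = card (p ` V) - 1" using assms by simp
qed

lemma card_fibre_diff_le:
  assumes "finite V" "\<And>c. card {y \<in> V. p y = c} \<le> m"
  shows "card {y \<in> V - S. p y = c} \<le> m"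
  by (rule order_trans[OF card_mono assms(2)[of c]]) (use assms(1) in auto)

section \<open>Counting all acyclic orientations\<close>

text \<open>An orientation is classified by the part that contains its sinks:
  \<open>sink_exists\<close> shows that the classes cover everything, and
  \<open>sinks_same_label\<close> that they are disjoint.\<close>

lemma card_acyclic_orientations_by_label:
  assumes "finite V" "V \<noteq> {}"
  shows "card (acyclic_orientations (label_edges V p)) =
    (\<Sum>c\<in>p ` V. card {D \<in> acyclic_orientations (label_edges V p).
                       sinks V D \<inter> {y \<in> V. p y = c} \<noteq> {}})"
proof -
  let ?A = "acyclic_orientations (label_edges V p)"
  let ?B = "\<lambda>c. {D \<in> ?A. sinks V D \<inter> {y \<in> V. p y = c} \<noteq> {}}"
  have "(\<Union>c\<in>p ` V. ?B c) = ?A"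
  proof (intro equalityI subsetI)
    fix D assume D: "D \<in> ?A"
    then obtain x where "x \<in> sinks V D" using sink_exists[OF assms] by blast
    then show "D \<in> (\<Union>c\<in>p ` V. ?B c)" using D by (auto simp: sinks_def)
  qed auto
  moreover have "card (\<Union>c\<in>p ` V. ?B c) = (\<Sum>c\<in>p ` V. card (?B c))"
  proof (rule card_UN_disjoint)
    show "\<forall>c\<in>p ` V. finite (?B c)" by (intro ballI finite_acyclic_orientations[OF assms(1)])
    show "\<forall>c\<in>p ` V. \<forall>d\<in>p ` V. c \<noteq> d \<longrightarrow> ?B c \<inter> ?B d = {}"
      using sinks_same_label[of _ V p] by blast
  qed (use assms(1) in simp)
  ultimately show ?thesis by simp
qed

text \<open>Every label is taken once or twice, so the vertices outnumber the labels by the number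
  of pairs. The second identity is additive to avoid truncated subtraction.\<close>

lemma card_fibres_two:
  fixes p :: "'a \<Rightarrow> 'b"
  assumes "finite V" "\<And>c. card {y \<in> V. p y = c} \<le> 2"
  shows "card {c \<in> p ` V. card {y \<in> V. p y = c} = 2} = card V - card (p ` V)"
    and "card {c \<in> p ` V. card {y \<in> V. p y = c} \<noteq> 2} + card V = 2 * card (p ` V)"
proof -
  let ?f = "\<lambda>c. card {y \<in> V. p y = c}"
  have f: "?f c = 1 + (if ?f c = 2 then 1 else 0)" if "c \<in> p ` V" for c
  proof -
    have "?f c \<noteq> 0" using that assms(1) by auto
    then show ?thesis using assms(2)[of c] by auto
  qed
  have "card V = (\<Sum>c\<in>p ` V. ?f c)"
    using sum.image_gen[OF assms(1), of "\<lambda>_. 1::nat" p] by simp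
  also have "\<dots> = (\<Sum>c\<in>p ` V. 1 + (if ?f c = 2 then 1 else 0))"
    using f by (rule sum.cong[OF refl])
  also have "\<dots> = card (p ` V) + card {c \<in> p ` V. ?f c = 2}"
    using assms(1) by (simp only: sum.distrib) (simp add: sum.If_cases Int_def)
  finally have 1: "card V = card (p ` V) + card {c \<in> p ` V. ?f c = 2}" .
  have "card (p ` V) = card {c \<in> p ` V. ?f c = 2} + card {c \<in> p ` V. ?f c \<noteq> 2}"
    using assms(1) by (subst card_Un_disjoint[symmetric]) (auto intro: arg_cong[of _ _ card])
  with 1 show "card {c \<in> p ` V. ?f c = 2} = card V - card (p ` V)"
    "card {c \<in> p ` V. ?f c \<noteq> 2} + card V = 2 * card (p ` V)" by auto
qed

text \<open>Induction on the number of vertices. Deleting sinks turns the count by parts into counts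
  for smaller graphs, and the resulting recursion is \<open>fact_diff_rec\<close>.\<close>

lemma card_acyclic_orientations:
  fixes p :: "'a \<Rightarrow> 'b"
  assumes "finite V" "\<And>c. card {y \<in> V. p y = c} \<le> 2"
  shows "int (card (acyclic_orientations (label_edges V p))) =
    (backward_diff ^^ (card V - card (p ` V))) shifted_fact (card V + 1)"
  using assms
proof (induction "card V" arbitrary: V rule: less_induct)
  case less
  show ?case
  proof (cases "V = {}")
    case True
    then have "acyclic_orientations (label_edges V p) = {{}}"
      by (auto simp: acyclic_orientations_def orientation_def acyclic_def)
    then show ?thesis using True by (simp add: shifted_fact_def)
  next
    case False
    let ?A = "acyclic_orientations (label_edges V p)"
    let ?B = "\<lambda>c. {D \<in> ?A. sinks V D \<inter> {y \<in> V. p y = c} \<noteq> {}}"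
    let ?f = "\<lambda>c. card {y \<in> V. p y = c}"
    define n where "n = card V - 1"
    define k where "k = card V - card (p ` V)"
    \<comment> \<open>By the induction hypothesis, \<open>X\<close> counts the acyclic orientations
      left after deleting a singleton part, and \<open>Y\<close> those left after deleting one
      vertex of a pair. The index is \<open>card V\<close> because one vertex is gone and the
      formula shifts by one.\<close>
    define X where "X = (backward_diff ^^ k) shifted_fact (card V)"
    define Y where "Y = (backward_diff ^^ (k - 1)) shifted_fact (card V)"
    note V = less.prems(1)
    have pos: "card V > 0" using V False by (simp add: card_gt_0_iff)
    have ppos: "card (p ` V) > 0" using V False by (simp add: card_gt_0_iff)
    have ple: "card (p ` V) \<le> card V" using V by (rule card_image_le)
    have IH: "int (card (acyclic_orientations (label_edges (V - S) p))) =
        (backward_diff ^^ (card (V - S) - card (p ` (V - S)))) shifted_fact (card (V - S) + 1)"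
      if "S \<subseteq> V" "S \<noteq> {}" for S
      using that V less.prems(2)
      by (intro less.hyps card_fibre_diff_le psubset_card_mono) auto
    have B: "int (card (?B c)) = (if ?f c = 2 then X + Y else X)" if "c \<in> p ` V" for c
    proof -
      from that obtain x where x: "x \<in> V" "c = p x" by blast
      show ?thesis
      proof (cases rule: fibre_cases[OF V less.prems(2) x(1), case_names single pair])
        case single
        have "?B c = {D \<in> ?A. {x} \<subseteq> sinks V D}" unfolding x(2) single by auto
        then have "int (card (?B c)) = int (card (acyclic_orientations (label_edges (V - {x}) p)))"
          using card_prescribed_sinks[of "{x}" V p c] x by simp
        also have "\<dots> = X"
          using IH[of "{x}"] x card_image_remove_single[OF V x(1) single] pos ppos V
          by (simp add: X_def k_def)
        finally show ?thesis using single x by simp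
      next
        case (pair y)
        \<comment> \<open>Deleting \<open>x\<close> loses no label, so there are fewer labels than
          vertices. Thus \<open>k - 1\<close> is a true predecessor.\<close>
        have k: "k > 0"
        proof -
          have "card (p ` (V - {x})) \<le> card (V - {x})" using V by (intro card_image_le) simp
          then show ?thesis
            using card_image_remove_pair(1)[OF V x(1) pair] pos V x by (simp add: k_def)
        qed
        let ?H = "\<lambda>S. {D \<in> ?A. S \<subseteq> sinks V D}"
        have fin: "finite (?H S)" for S by (rule finite_acyclic_orientations[OF V])
        \<comment> \<open>Inclusion-exclusion over the two possible sinks of the part, kept additive
          over the naturals.\<close>
        have "?B c = ?H {x} \<union> ?H {y}" unfolding x(2) pair(4) by auto
        moreover have "?H {x} \<inter> ?H {y} = ?H {x, y}" by blast
        ultimately have union: "card (?B c) + card (?H {x, y}) = card (?H {x}) + card (?H {y})"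
          using card_Un_Int[OF fin fin, of "{x}" "{y}"] by simp
        have one: "int (card (?H {z})) = Y" if "z \<in> {x, y}" for z
        proof -
          have "card (p ` (V - {z})) = card (p ` V)"
            using that card_image_remove_pair(1)[OF V x(1) pair]
              card_image_remove_pair(1)[of V y x p] V x pair by auto
          then show ?thesis
            using card_prescribed_sinks[of "{z}" V p c] IH[of "{z}"] that x pair pos V
            by (auto simp: Y_def k_def diff_commute)
        qed
        \<comment> \<open>Without the pair there remain \<open>k - 1\<close> pairs on two fewer
          vertices, so the index drops once more than in \<open>Y\<close>. This value is
          \<open>Y - X\<close> because \<open>X\<close> is the backward difference of the sequence
          behind \<open>Y\<close>; the pair therefore contributes 2 Y - (Y - X) = X + Y.\<close>
        have both: "int (card (?H {x, y})) = Y - X"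
        proof -
          have c: "card (V - {x, y}) = card V - 2" using V x pair by (simp add: card_Diff_subset)
          have "card V \<ge> 2" using card_mono[OF V, of "{x, y}"] x pair by simp
          then obtain m where m: "card V = Suc (Suc m)" using less_eqE by (metis add_2_eq_Suc)
          have d: "card (V - {x, y}) - card (p ` (V - {x, y})) = k - 1"
            using c card_image_remove_pair(2)[OF V x(1) pair] ppos k by (simp add: k_def)
          have "int (card (?H {x, y})) = (backward_diff ^^ (k - 1)) shifted_fact (Suc m)"
          proof -
            have "card (?H {x, y}) = card (acyclic_orientations (label_edges (V - {x, y}) p))"
              by (rule card_prescribed_sinks[where c = c]) (use x pair in auto)
            moreover have "card (V - {x, y}) + 1 = Suc m" using c m by simp
            ultimately show ?thesis using IH[of "{x, y}"] x pair d by simp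
          qed
          also have "\<dots> = Y - X"
            using k m by (cases k) (simp_all add: X_def Y_def backward_diff_def)
          finally show ?thesis .
        qed
        have "int (card (?B c)) = X + Y"
          using arg_cong[OF union, of int] one[of x] one[of y] both
          unfolding of_nat_add by simp
        moreover have "?f c = 2" using pair(2) unfolding x(2) pair(4) by simp
        ultimately show ?thesis by simp
      qed
    qed
    have "int (card ?A) = (\<Sum>c\<in>p ` V. int (card (?B c)))"
      using card_acyclic_orientations_by_label[OF V False, of p] by simp
    also have "\<dots> = (\<Sum>c\<in>p ` V. if ?f c = 2 then X + Y else X)"
      using B by (rule sum.cong[OF refl])
    also have "\<dots> = int (card {c \<in> p ` V. ?f c = 2}) * (X + Y) +
        int (card {c \<in> p ` V. ?f c \<noteq> 2}) * X"
      using V by (simp add: sum.If_cases Int_def)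
    \<comment> \<open>Each of the \<open>card V - k\<close> parts contributes one \<open>X\<close>,
      and each of the \<open>k\<close> pairs a further \<open>Y\<close>.\<close>
    also have "\<dots> = int (card V - k) * X + int k * Y"
    proof -
      have a: "card {c \<in> p ` V. ?f c = 2} = k"
        and b: "card {c \<in> p ` V. ?f c \<noteq> 2} + card V = 2 * card (p ` V)"
        using card_fibres_two[OF V less.prems(2)] by (simp_all add: k_def)
      have "int (card {c \<in> p ` V. ?f c \<noteq> 2}) = int (card V - k) - int k"
        using b ple by (simp add: k_def)
      then have c: "int (card V - k) = int (card {c \<in> p ` V. ?f c \<noteq> 2}) + int k" by simp
      show ?thesis unfolding a c by (simp only: algebra_simps)
    qed
    also have "\<dots> = (backward_diff ^^ k) shifted_fact (card V + 1)"
      using fact_diff_rec[of k "card V"] ppos ple by (simp add: X_def Y_def k_def)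
    finally show ?thesis by (simp add: k_def)
  qed
qed

section \<open>Orientations with a prescribed unique sink\<close>

text \<open>Any further sink lies in the part of \<open>s\<close>. If \<open>s\<close> is alone
  there, deleting it gives the count directly. If it has a partner \<open>y\<close>, the
  orientations in which \<open>y\<close> is a sink too are subtracted, and this subtraction is one
  more backward difference.\<close>

lemma card_unique_sink:
  fixes p :: "'a \<Rightarrow> 'b"
  assumes V: "finite V" "\<And>c. card {y \<in> V. p y = c} \<le> 2" and s: "s \<in> V"
  shows "int (num_unique_sink V (label_edges V p) s) =
    (backward_diff ^^ (card V - card (p ` V))) shifted_fact (card V)"
proof -
  let ?A = "acyclic_orientations (label_edges V p)"
  let ?H = "\<lambda>S. {D \<in> ?A. S \<subseteq> sinks V D}"
  have u: "num_unique_sink V (label_edges V p) s = card {D \<in> ?A. sinks V D = {s}}"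
    by (simp add: num_unique_sink_def acyclic_orientations_def conj_assoc)
  have pos: "card V > 0" "card (p ` V) > 0" using V(1) s by (auto simp: card_gt_0_iff)
  have total: "int (card (?H S)) =
      (backward_diff ^^ (card (V - S) - card (p ` (V - S)))) shifted_fact (card (V - S) + 1)"
    if "S \<subseteq> V" "\<And>x. x \<in> S \<Longrightarrow> p x = p s" for S
    using card_prescribed_sinks[OF that] card_acyclic_orientations[of "V - S" p]
      card_fibre_diff_le[OF V] V(1) by simp
  show ?thesis
  proof (cases rule: fibre_cases[OF V s, case_names single pair])
    case single
    have "{D \<in> ?A. sinks V D = {s}} = ?H {s}"
    proof (intro equalityI subsetI)
      fix D assume D: "D \<in> ?H {s}"
      then have "sinks V D \<subseteq> {y \<in> V. p y = p s}"
        using sinks_same_label[of D V p _ s] unfolding sinks_def by blast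
      then show "D \<in> {D \<in> ?A. sinks V D = {s}}" using D single by auto
    qed auto
    then show ?thesis
      using u total[of "{s}"] s card_image_remove_single[OF V(1) s single] pos V(1) by simp
  next
    case (pair y)
    have "{D \<in> ?A. sinks V D = {s}} = ?H {s} - ?H {s, y}"
    proof (intro equalityI subsetI)
      fix D assume D: "D \<in> ?H {s} - ?H {s, y}"
      then have "sinks V D \<subseteq> {y \<in> V. p y = p s}"
        using sinks_same_label[of D V p _ s] unfolding sinks_def by blast
      then show "D \<in> {D \<in> ?A. sinks V D = {s}}" using D pair by auto
    qed (use pair in auto)
    moreover have sub: "?H {s, y} \<subseteq> ?H {s}" by auto
    moreover have fin: "finite (?H {s})" by (rule finite_acyclic_orientations[OF V(1)])
    ultimately have *: "int (num_unique_sink V (label_edges V p) s) =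
        int (card (?H {s})) - int (card (?H {s, y}))"
      using u card_mono[OF fin sub] by (simp add: card_Diff_subset finite_subset)
    have "card V \<ge> 2" using card_mono[OF V(1), of "{s, y}"] s pair by simp
    then obtain m where m: "card V = Suc (Suc m)" using less_eqE by (metis add_2_eq_Suc)
    have c: "card (V - {s, y}) = m" using V(1) s pair m by (simp add: card_Diff_subset)
    have "card (p ` (V - {s})) \<le> card (V - {s})" using V(1) by (intro card_image_le) simp
    \<comment> \<open>Here \<open>j\<close> is the number of pairs left after deleting
      \<open>s\<close>, and also after deleting both \<open>s\<close> and \<open>y\<close>. The two
      counts are thus neighbouring values of the same \<open>j\<close>-fold difference.\<close>
    then obtain j where j: "card V - card (p ` V) = Suc j" "Suc m - card (p ` V) = j"
      using card_image_remove_pair(1)[OF V(1) s pair] V(1) s m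
      by (simp add: Suc_diff_le)
    have 1: "int (card (?H {s})) = (backward_diff ^^ j) shifted_fact (Suc (Suc m))"
      using total[of "{s}"] s card_image_remove_pair(1)[OF V(1) s pair] V(1) m j by simp
    have "m - (card (p ` V) - 1) = j" using j pos by simp
    then have 2: "int (card (?H {s, y})) = (backward_diff ^^ j) shifted_fact (Suc m)"
      using total[of "{s, y}"] s pair card_image_remove_pair(2)[OF V(1) s pair] c by auto
    show ?thesis unfolding j(1) using * 1 2 by (simp add: m backward_diff_def)
  qed
qed

section \<open>From Turan graphs to labellings\<close>

text \<open>Labelling each vertex by the part that contains it transfers the counts for
  \<open>label_edges\<close> to graphs given by a partition.\<close>

lemma partition_on_labelling:
  assumes "partition_on V P"
  obtains p where "\<And>A x. A \<in> P \<Longrightarrow> x \<in> A \<Longrightarrow> p x = A" "p ` V = P"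
    "complete_multipartite_edges P = label_edges V p"
proof
  let ?p = "\<lambda>x. THE A. A \<in> P \<and> x \<in> A"
  have V: "V = \<Union> P" and ne: "{} \<notin> P" and dis: "disjoint P"
    using assms by (auto simp: partition_on_def)
  show p: "?p x = A" if "A \<in> P" "x \<in> A" for A x
    using that dis by (intro the_equality) (auto simp: disjoint_def)
  show "?p ` V = P"
  proof (intro equalityI subsetI)
    fix A assume A: "A \<in> P"
    then obtain x where "x \<in> A" using ne by fastforce
    then show "A \<in> ?p ` V" using p[OF A, of x] A V by (intro image_eqI[of _ _ x]) auto
  qed (use p V in auto)
  have "(\<exists>A\<in>P. \<exists>B\<in>P. A \<noteq> B \<and> x \<in> A \<and> y \<in> B) \<longleftrightarrow> x \<in> V \<and> y \<in> V \<and> ?p x \<noteq> ?p y" for x y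
  proof
    assume "\<exists>A\<in>P. \<exists>B\<in>P. A \<noteq> B \<and> x \<in> A \<and> y \<in> B"
    then obtain A B where AB: "A \<in> P" "B \<in> P" "A \<noteq> B" "x \<in> A" "y \<in> B" by blast
    then show "x \<in> V \<and> y \<in> V \<and> ?p x \<noteq> ?p y" using p[of A x] p[of B y] V by auto
  next
    assume *: "x \<in> V \<and> y \<in> V \<and> ?p x \<noteq> ?p y"
    then obtain A B where AB: "A \<in> P" "B \<in> P" "x \<in> A" "y \<in> B" using V by blast
    then have "A \<noteq> B" using * p[of A x] p[of B y] by auto
    then show "\<exists>A\<in>P. \<exists>B\<in>P. A \<noteq> B \<and> x \<in> A \<and> y \<in> B" using AB by blast
  qed
  then show "complete_multipartite_edges P = label_edges V ?p"
    by (simp add: complete_multipartite_edges_def label_edges_def)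
qed

text \<open>Since \<open>k\<close> is at most \<open>r\<close>, the quotient (r + k) / r is at most
  2, and so is every part size. With \<open>r\<close> parts on \<open>r + k\<close> vertices, the
  order of the difference is \<open>k\<close>.\<close>

lemma num_unique_sink_turan:
  assumes r: "r \<ge> max k 1" and T: "turan_graph (r + k) r V E" and s: "s \<in> V"
  shows "int (num_unique_sink V E s) = (backward_diff ^^ k) shifted_fact (r + k)"
proof -
  from T obtain P where V: "finite V" "card V = r + k" and P: "partition_on V P" "card P = r"
    and size: "\<And>A. A \<in> P \<Longrightarrow> int (card A) = \<lceil>real (r + k) / real r\<rceil> \<or>
      int (card A) = \<lfloor>real (r + k) / real r\<rfloor>"
    and E: "E = complete_multipartite_edges P"
    unfolding turan_graph_def by blast
  obtain p where p: "\<And>A x. A \<in> P \<Longrightarrow> x \<in> A \<Longrightarrow> p x = A" "p ` V = P"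
    "complete_multipartite_edges P = label_edges V p"
    using partition_on_labelling[OF P(1)] by blast
  have "real (r + k) / real r \<le> 2" using r by (simp add: field_simps)
  then have "\<lceil>real (r + k) / real r\<rceil> \<le> 2" "\<lfloor>real (r + k) / real r\<rfloor> \<le> 2"
    by linarith+
  then have le2: "card A \<le> 2" if "A \<in> P" for A using size[OF that] by linarith
  have "card {y \<in> V. p y = c} \<le> 2" for c
  proof (cases "c \<in> P")
    case True
    have "{y \<in> V. p y = c} \<subseteq> c"
    proof
      fix y assume y: "y \<in> {y \<in> V. p y = c}"
      then obtain B where "B \<in> P" "y \<in> B" using P(1) unfolding partition_on_def by blast
      then show "y \<in> c" using p(1)[of B y] y by simp
    qed
    moreover have "finite c"
      using True V(1) P(1) by (metis Union_upper finite_subset partition_onD1)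
    ultimately show ?thesis using card_mono le2[OF True] order_trans by blast
  next
    case False
    then have "{y \<in> V. p y = c} = {}" using p(2) by auto
    then show ?thesis by (simp only: card.empty)
  qed
  from card_unique_sink[OF V(1) this s] show ?thesis using V P p E by simp
qed

theorem theorem7p1:
  fixes k r :: nat and V :: "'a set" and E :: "'a set set" and s :: 'a
  assumes "r \<ge> max k 1"
    and "turan_graph (r + k) r V E" and "s \<in> V"
  shows "int (num_unique_sink V E s) = (backward_diff ^^ k) shifted_fact (r + k) \<and>
    (k \<ge> 1 \<longrightarrow>
      (\<forall>(V1 :: 'b set) E1 s1 (V2 :: 'c set) E2 s2.
         turan_graph (r + k) (r + 1) V1 E1 \<and> s1 \<in> V1 \<and>
         turan_graph (r + k - 1) r V2 E2 \<and> s2 \<in> V2 \<longrightarrow>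
         int (num_unique_sink V E s) =
           int (num_unique_sink V1 E1 s1) - int (num_unique_sink V2 E2 s2)))"
proof (intro conjI impI allI)
  show u: "int (num_unique_sink V E s) = (backward_diff ^^ k) shifted_fact (r + k)"
    using assms by (rule num_unique_sink_turan)
  fix V1 :: "'b set" and E1 s1 and V2 :: "'c set" and E2 s2
  assume "1 \<le> k" and *: "turan_graph (r + k) (r + 1) V1 E1 \<and> s1 \<in> V1 \<and>
    turan_graph (r + k - 1) r V2 E2 \<and> s2 \<in> V2"
  then obtain j where k: "k = Suc j" by (cases k) auto
  \<comment> \<open>Both graphs have \<open>j\<close> more vertices than parts: r + k = (r + 1) + j
    and r + k - 1 = r + j. Their counts are consecutive values of the \<open>j\<close>-fold
    difference, so subtracting them gives the \<open>k\<close>-fold one.\<close>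
  have "int (num_unique_sink V1 E1 s1) = (backward_diff ^^ j) shifted_fact (r + 1 + j)"
    by (rule num_unique_sink_turan) (use * k assms(1) in auto)
  moreover have "int (num_unique_sink V2 E2 s2) = (backward_diff ^^ j) shifted_fact (r + j)"
    by (rule num_unique_sink_turan) (use * k assms(1) in auto)
  ultimately show "int (num_unique_sink V E s) =
      int (num_unique_sink V1 E1 s1) - int (num_unique_sink V2 E2 s2)"
    using u by (simp add: k backward_diff_def)
qed

end
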